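(* For every constant $C>0$ there exist constants $C_0,c_0>0$ depending only on $C$ such that the following holds. Let $b,d\ge3$ be integers, $p=bd$, and let $\{1,\dots,p\}$ be partitioned into $d$ groups of equal size $b_1=\dots=b_d=b$. Let $s,s_g$ be positive integers with $d\ge s_g$ and $s_gb\ge s\ge s_g$. Assume there exist a matrix $X\in\mathbb{R}^{n\times(bd)}$ and a map $\Delta:\mathbb{R}^n\to\mathbb{R}^{bd}$ (which may depend on $X$) such that $$\|\beta-\Delta(X\beta)\|_2\le C\left(\frac{\|\beta\|_1}{\sqrt{s}}+\frac{\|\beta\|_{1,2}}{\sqrt{s_g}}\right)\qquad\text{for all }\beta\in\mathbb{R}^p .$$ If $s_g\ge C_0$, then $$n\ge c_0\left(s_g\log(d/s_g)+s\log(es_gb/s)\right).$$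
   Context: For $\beta\in\mathbb{R}^p$ with groups $(1),\dots,(d)$, $\beta_{(j)}$ denotes the subvector on group $j$, $\|\beta\|_1=\sum_i|\beta_i|$ and $\|\beta\|_{1,2}=\sum_{j=1}^d\|\beta_{(j)}\|_2$. *)

theory Defs
  imports
    "HOL-Analysis.L2_Norm"
    "HOL-Library.Disjoint_Sets"
    "HOL-Library.FuncSet"
    "Jordan_Normal_Form.Matrix"
begin

definition vec_norm1 :: "real vec \<Rightarrow> real" where
  "vec_norm1 v = (\<Sum>i<dim_vec v. \<bar>v $ i\<bar>)"

definition vec_norm2 :: "real vec \<Rightarrow> real" where
  "vec_norm2 v = L2_set (\<lambda>i. v $ i) {..<dim_vec v}"

text \<open>The groups are the blocks of a partition \<open>P\<close> of the index set; the subvector of \<open>v\<close> on a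
  block \<open>G\<close> enters only through its Euclidean norm.\<close>

definition vec_norm12 :: "nat set set \<Rightarrow> real vec \<Rightarrow> real" where
  "vec_norm12 P v = (\<Sum>G\<in>P. L2_set (\<lambda>i. v $ i) G)"

text \<open>Matrices and vectors are indexed from \<open>0\<close>, so the index set is \<open>{..<b * d}\<close>.\<close>

definition equal_groups :: "nat \<Rightarrow> nat \<Rightarrow> nat set set \<Rightarrow> bool" where
  "equal_groups b d P \<longleftrightarrow>
     partition_on {..<b * d} P \<and> card P = d \<and> (\<forall>G\<in>P. card G = b)"

end

theory Submission
  imports Defs
begin

text \<open>
  Applying the recovery bound to \<open>v\<close> and \<open>-v\<close> for \<open>v\<close> in the kernel of \<open>X\<close> bounds \<open>\<parallel>v\<parallel>\<^sub>2\<close> by \<open>C\<close> times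
  the mixed norm of \<open>v\<close>. This is a null space property: sufficiently sparse vectors have minimal mixed
  norm in their coset modulo the kernel. Hence indicator vectors of sparse sets with small pairwise
  intersections, whose mutual mixed distances all lie between \<open>\<delta>\<close> and \<open>31 \<delta>\<close>, stay
  \<open>\<delta>\<close>-separated in the quotient by the kernel, which has dimension at most \<open>n\<close>, so that there are at
  most \<open>32 ^ n\<close> of them. Taking the sets inside a transversal of the groups gives the term
  \<open>s\<^sub>g log (d / s\<^sub>g)\<close>; taking them inside a union of about \<open>s\<^sub>g\<close> groups gives the other term.

  The packing bound needs no volume: if \<open>M\<close> points are \<open>\<delta>\<close>-separated with diameter at most
  \<open>(L - 1) \<delta>\<close>, then the \<open>M ^ K\<close> base-\<open>L\<close> expansions of length \<open>K\<close> with these points as digits are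
  \<open>\<delta>\<close>-separated as well, while their \<open>n\<close> coordinates are \<open>O(L ^ K)\<close>. Pigeonhole on a grid gives
  \<open>M ^ K = O((L ^ n) ^ K)\<close> for every \<open>K\<close>.
\<close>

subsection \<open>Packing modulo a subspace of finite codimension\<close>

text \<open>Vectors are arbitrary functions on \<open>nat\<close>, so no dimension has to be
  tracked: only the number of functionals enters the packing bound.\<close>

definition lin_fun :: "((nat \<Rightarrow> real) \<Rightarrow> real) \<Rightarrow> bool" where
  "lin_fun f \<longleftrightarrow> (\<forall>x y c. f (\<lambda>i. x i + c * y i) = f x + c * f y)"

text \<open>Definiteness is not demanded, because the mixed norm ignores entries outside the index
  set.\<close>

definition seminorm :: "((nat \<Rightarrow> real) \<Rightarrow> real) \<Rightarrow> bool" where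
  "seminorm N \<longleftrightarrow> (\<forall>x y. N (\<lambda>i. x i + y i) \<le> N x + N y) \<and> (\<forall>c x. N (\<lambda>i. c * x i) = \<bar>c\<bar> * N x)"

lemma lin_funD: "lin_fun f \<Longrightarrow> f (\<lambda>i. x i + c * y i) = f x + c * f y"
  by (simp add: lin_fun_def)

lemma lin_fun_zero: "lin_fun f \<Longrightarrow> f (\<lambda>i. 0) = 0"
  using lin_funD[of f "\<lambda>i. 0" 1 "\<lambda>i. 0"] by simp

lemma lin_fun_scale: "lin_fun f \<Longrightarrow> f (\<lambda>i. c * x i) = c * f x"
  using lin_funD[of f "\<lambda>i. 0" c x] lin_fun_zero[of f] by simp

lemma lin_fun_diff: "lin_fun f \<Longrightarrow> f (\<lambda>i. x i - y i) = f x - f y"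
  using lin_funD[of f x "-1" y] by simp

lemma seminorm_add: "seminorm N \<Longrightarrow> N (\<lambda>i. x i + y i) \<le> N x + N y"
  by (simp add: seminorm_def)

lemma seminorm_scale: "seminorm N \<Longrightarrow> N (\<lambda>i. c * x i) = \<bar>c\<bar> * N x"
  by (simp add: seminorm_def)

lemma seminorm_zero: "seminorm N \<Longrightarrow> N (\<lambda>i. 0) = 0"
  using seminorm_scale[of N 0 "\<lambda>i. 0"] by simp

lemma seminorm_nonneg:
  assumes "seminorm N"
  shows "0 \<le> N x"
  using seminorm_add[OF assms, of x "\<lambda>i. -1 * x i"] seminorm_scale[OF assms, of "-1" x]
    seminorm_zero[OF assms] by simp

lemma seminorm_sum_le:
  assumes "seminorm N"
  shows "N (\<lambda>i. \<Sum>j<(n::nat). c j * u j i) \<le> (\<Sum>j<n. \<bar>c j\<bar> * N (u j))"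
proof (induction n)
  case 0
  show ?case using seminorm_zero[OF assms] by simp
next
  case (Suc n)
  have "N (\<lambda>i. \<Sum>j<Suc n. c j * u j i) \<le> N (\<lambda>i. \<Sum>j<n. c j * u j i) + N (\<lambda>i. c n * u n i)"
    using seminorm_add[OF assms, of "\<lambda>i. \<Sum>j<n. c j * u j i" "\<lambda>i. c n * u n i"] by simp
  then show ?case using Suc seminorm_scale[OF assms, of "c n" "u n"] by simp
qed

lemma seminorm_add_scale_ge:
  assumes "seminorm N"
  shows "\<bar>c\<bar> * N y - N x \<le> N (\<lambda>i. x i + c * y i)"
proof -
  have "N (\<lambda>i. c * y i) \<le> N (\<lambda>i. x i + c * y i) + N (\<lambda>i. -1 * x i)"
    using seminorm_add[OF assms, of "\<lambda>i. x i + c * y i" "\<lambda>i. -1 * x i"] by simp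
  then show ?thesis
    using seminorm_scale[OF assms, of c y] seminorm_scale[OF assms, of "-1" x] by simp
qed

text \<open>Gaussian elimination, one functional at a time. Up to a common zero of the functionals,
  every \<open>x\<close> is a combination of \<open>n\<close> fixed vectors \<open>u j\<close>, so a
  coset of the common kernel is described by \<open>n\<close> linear coordinates.\<close>

lemma common_kernel_projection:
  assumes "\<And>k. k < n \<Longrightarrow> lin_fun (f k)"
  shows "\<exists>c u. (\<forall>j<n. lin_fun (c j)) \<and>
    (\<forall>x. \<forall>k<n. f k (\<lambda>i. x i - (\<Sum>j<(n::nat). c j x * u j i)) = 0)"
  using assms
proof (induction n)
  case 0
  show ?case by simp
next
  case (Suc n)
  then obtain c u where c: "\<And>j. j < n \<Longrightarrow> lin_fun (c j)"
    and cu: "\<And>x k. k < n \<Longrightarrow> f k (\<lambda>i. x i - (\<Sum>j<n. c j x * u j i)) = 0"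
    by (metis less_Suc_eq)
  define \<pi> where "\<pi> x i = (\<Sum>j<n. c j x * u j i)" for x i
  have \<pi>: "\<pi> (\<lambda>i. x i + a * y i) i = \<pi> x i + a * \<pi> y i" for x y a i
    unfolding \<pi>_def sum_distrib_left sum.distrib[symmetric]
    by (rule sum.cong) (auto simp: lin_funD[OF c] algebra_simps)
  \<comment> \<open>\<open>g\<close> is what remains of the new functional after the earlier ones
    have been eliminated. If it vanishes, nothing more has to be removed; otherwise some residual
    \<open>w\<close> has \<open>f n w \<noteq> 0\<close>, is killed by the earlier functionals, and
    serves as the new direction.\<close>
  define g where "g x = f n (\<lambda>i. x i - \<pi> x i)" for x
  have g: "lin_fun g"
    unfolding lin_fun_def
  proof (intro allI)
    fix x y a
    have "(\<lambda>i. x i + a * y i - \<pi> (\<lambda>i. x i + a * y i) i) = (\<lambda>i. (x i - \<pi> x i) + a * (y i - \<pi> y i))"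
      by (auto simp: \<pi> algebra_simps)
    then show "g (\<lambda>i. x i + a * y i) = g x + a * g y"
      unfolding g_def by (simp add: lin_funD[OF Suc.prems])
  qed
  show ?case
  proof (cases "\<forall>x. g x = 0")
    case True
    \<comment> \<open>A dummy coordinate keeps the count at \<open>Suc n\<close>.\<close>
    let ?c = "c(n := \<lambda>_. 0)"
    have "lin_fun (?c j)" if "j < Suc n" for j
      using that c by (auto simp: less_Suc_eq lin_fun_def)
    moreover have "f k (\<lambda>i. x i - (\<Sum>j<Suc n. ?c j x * u j i)) = 0" if "k < Suc n" for x k
      using that cu True by (auto simp: less_Suc_eq g_def \<pi>_def)
    ultimately show ?thesis by blast
  next
    case False
    then obtain x0 where x0: "g x0 \<noteq> 0" by blast
    define w where "w i = x0 i - \<pi> x0 i" for i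
    let ?c = "c(n := \<lambda>x. g x / g x0)" and ?u = "u(n := w)"
    have "lin_fun (?c j)" if "j < Suc n" for j
      using that c g by (auto simp: less_Suc_eq lin_fun_def add_divide_distrib)
    moreover have "f k (\<lambda>i. x i - (\<Sum>j<Suc n. ?c j x * ?u j i)) = 0" if k: "k < Suc n" for x k
    proof -
      have "(\<lambda>i. x i - (\<Sum>j<Suc n. ?c j x * ?u j i)) = (\<lambda>i. (x i - \<pi> x i) + (- (g x / g x0)) * w i)"
        by (auto simp: \<pi>_def)
      then have "f k (\<lambda>i. x i - (\<Sum>j<Suc n. ?c j x * ?u j i))
          = f k (\<lambda>i. x i - \<pi> x i) + (- (g x / g x0)) * f k w"
        using lin_funD[OF Suc.prems[OF k], of "\<lambda>i. x i - \<pi> x i" "- (g x / g x0)" w] by simp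
      also have "\<dots> = 0"
      proof (cases "k = n")
        case True
        have "f n w = g x0" unfolding g_def w_def by simp
        then show ?thesis using x0 True by (simp add: g_def)
      next
        case False
        then have "k < n" using k by simp
        then show ?thesis using cu[of k x] cu[of k x0] unfolding \<pi>_def w_def by simp
      qed
      finally show ?thesis .
    qed
    ultimately show ?thesis by blast
  qed
qed

section \<open>Base-\<open>L\<close> expansions and the packing bound\<close>

fun expansion :: "nat \<Rightarrow> ('a \<Rightarrow> nat \<Rightarrow> real) \<Rightarrow> 'a list \<Rightarrow> nat \<Rightarrow> real" where
  "expansion L x [] = (\<lambda>i. 0)"
| "expansion L x (a # as) = (\<lambda>i. x a i + real L * expansion L x as i)"

text \<open>The head of the list is the least significant digit. If the tails agree, they cancel and
  the heads are separated. Otherwise the tails differ by at least \<open>\<delta>\<close> modulo the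
  kernel, hence by \<open>L * \<delta>\<close> after the shift, and the heads take back at most
  \<open>(L - 1) * \<delta>\<close>.\<close>

lemma expansion_separated:
  assumes N: "seminorm N" and f: "\<And>k. k < n \<Longrightarrow> lin_fun (f k)" and L: "L \<ge> 1"
    and diam: "\<And>a b. a \<in> A \<Longrightarrow> b \<in> A \<Longrightarrow> N (\<lambda>i. x a i - x b i) \<le> (real L - 1) * \<delta>"
    and sep: "\<And>a b v. a \<in> A \<Longrightarrow> b \<in> A \<Longrightarrow> a \<noteq> b \<Longrightarrow> (\<And>k. k < n \<Longrightarrow> f k v = 0) \<Longrightarrow>
      \<delta> \<le> N (\<lambda>i. x a i - x b i - v i)"
    and "length as = length bs" "set as \<subseteq> A" "set bs \<subseteq> A" "as \<noteq> bs" "\<And>k. k < n \<Longrightarrow> f k v = 0"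
  shows "\<delta> \<le> N (\<lambda>i. expansion L x as i - expansion L x bs i - v i)"
  using assms(6-)
proof (induction as bs arbitrary: v rule: list_induct2)
  case Nil
  then show ?case by simp
next
  case (Cons a as b bs)
  show ?case
  proof (cases "as = bs")
    case True
    then have "a \<noteq> b" using Cons.prems by simp
    then show ?thesis using sep[of a b v] Cons.prems True by simp
  next
    case False
    \<comment> \<open>Dividing \<open>v\<close> by \<open>L\<close> keeps it in the kernel and lets
      the factor \<open>L\<close> be taken out of the whole tail difference.\<close>
    define w where "w i = (1 / real L) * v i" for i
    have w: "f k w = 0" if "k < n" for k
      using lin_fun_scale[OF f[OF that], of "1 / real L" v] Cons.prems(4)[OF that]
      unfolding w_def by simp
    have IH: "\<delta> \<le> N (\<lambda>i. expansion L x as i - expansion L x bs i - w i)"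
      by (rule Cons.IH) (use Cons.prems False w in auto)
    have "(\<lambda>i. expansion L x (a # as) i - expansion L x (b # bs) i - v i)
      = (\<lambda>i. (x a i - x b i) + real L * (expansion L x as i - expansion L x bs i - w i))"
      using L by (auto simp: w_def algebra_simps)
    then have "N (\<lambda>i. expansion L x (a # as) i - expansion L x (b # bs) i - v i)
      \<ge> real L * N (\<lambda>i. expansion L x as i - expansion L x bs i - w i) - N (\<lambda>i. x a i - x b i)"
      using seminorm_add_scale_ge[OF N, of "real L"] by simp
    moreover have "N (\<lambda>i. x a i - x b i) \<le> (real L - 1) * \<delta>"
      using diam Cons.prems by simp
    moreover have "real L * \<delta> \<le> real L * N (\<lambda>i. expansion L x as i - expansion L x bs i - w i)"
      using IH by (intro mult_left_mono) auto
    ultimately show ?thesis by (simp add: algebra_simps)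
  qed
qed

text \<open>The digit weights form a geometric sum, at most \<open>L ^ length as - 1\<close> for
  \<open>L \<ge> 2\<close>. Carrying the \<open>- 1\<close> along lets the induction absorb the new
  digit, with surplus \<open>B * (L - 2)\<close>.\<close>

lemma expansion_functional_bound:
  assumes c: "lin_fun c" and L: "L \<ge> 2" and B: "\<And>a. a \<in> A \<Longrightarrow> \<bar>c (x a)\<bar> \<le> B" "B \<ge> 0"
    and "set as \<subseteq> A"
  shows "\<bar>c (expansion L x as)\<bar> \<le> B * (real L ^ length as - 1)"
  using assms(5)
proof (induction as)
  case Nil
  then show ?case using lin_fun_zero[OF c] by simp
next
  case (Cons a as)
  have "\<bar>c (expansion L x (a # as))\<bar> \<le> \<bar>c (x a)\<bar> + real L * \<bar>c (expansion L x as)\<bar>"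
    using lin_funD[OF c, of "x a" "real L" "expansion L x as"]
      abs_triangle_ineq[of "c (x a)" "real L * c (expansion L x as)"]
    by (simp add: abs_mult)
  also have "\<dots> \<le> B + real L * (B * (real L ^ length as - 1))"
    using Cons B by (intro add_mono mult_left_mono) auto
  also have "\<dots> = B * (real L ^ length (a # as) - 1) - B * (real L - 2)"
    by (simp add: algebra_simps)
  also have "\<dots> \<le> B * (real L ^ length (a # as) - 1)"
    using L B(2) by simp
  finally show ?case .
qed

text \<open>The grid cells available to expansions of length \<open>K\<close> number at most
  \<open>D ^ n * (L ^ n) ^ K\<close>, with \<open>D\<close> independent of \<open>K\<close>. Letting
  \<open>K\<close> grow removes the factor \<open>D ^ n\<close>, so the crude choices of
  \<open>B\<close>, \<open>W\<close> and \<open>D\<close> cost nothing.\<close>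

lemma packing_bound:
  fixes A :: "'a set" and L n :: nat
  assumes N: "seminorm N" and f: "\<And>k. k < n \<Longrightarrow> lin_fun (f k)" and L: "L \<ge> 2" and \<delta>: "\<delta> > 0"
    and A: "finite A"
    and diam: "\<And>a b. a \<in> A \<Longrightarrow> b \<in> A \<Longrightarrow> N (\<lambda>i. x a i - x b i) \<le> (real L - 1) * \<delta>"
    and sep: "\<And>a b v. a \<in> A \<Longrightarrow> b \<in> A \<Longrightarrow> a \<noteq> b \<Longrightarrow> (\<And>k. k < n \<Longrightarrow> f k v = 0) \<Longrightarrow>
      \<delta> \<le> N (\<lambda>i. x a i - x b i - v i)"
  shows "card A \<le> L ^ n"
proof -
  obtain c u where c: "\<And>j. j < n \<Longrightarrow> lin_fun (c j)"
    and cu: "\<And>y k. k < n \<Longrightarrow> f k (\<lambda>i. y i - (\<Sum>j<n. c j y * u j i)) = 0"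
  proof -
    have "\<exists>c u. (\<forall>j<n. lin_fun (c j)) \<and> (\<forall>x. \<forall>k<n. f k (\<lambda>i. x i - (\<Sum>j<n. c j x * u j i)) = 0)"
      by (rule common_kernel_projection) (rule f)
    then show thesis using that by blast
  qed
  define B where "B = (\<Sum>a\<in>A. \<Sum>j<n. \<bar>c j (x a)\<bar>)"
  have B0: "B \<ge> 0" unfolding B_def by (intro sum_nonneg) auto
  have B: "\<bar>c j (x a)\<bar> \<le> B" if "a \<in> A" "j < n" for a j
  proof -
    have "\<bar>c j (x a)\<bar> \<le> (\<Sum>j<n. \<bar>c j (x a)\<bar>)"
      by (rule member_le_sum) (use that in auto)
    also have "\<dots> \<le> B" unfolding B_def
      by (rule member_le_sum[of a A]) (use that A in \<open>auto intro: sum_nonneg\<close>)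
    finally show ?thesis .
  qed
  \<comment> \<open>The summand 1 makes \<open>W\<close> positive and the later comparison
    \<open>\<eta> * (W - 1) < \<delta>\<close> strict.\<close>
  define W where "W = (\<Sum>j<n. N (u j)) + 1"
  have W: "W > 0" unfolding W_def by (intro add_nonneg_pos sum_nonneg seminorm_nonneg[OF N]) auto
  define \<eta> where "\<eta> = \<delta> / W"
  have \<eta>: "\<eta> > 0" using \<delta> W by (simp add: \<eta>_def)
  \<comment> \<open>In units of \<open>\<eta>\<close> each coordinate falls into one of
    \<open>2 * T + 1\<close> cells; rounding up in \<open>T\<close> costs at most another two, hence
    the 3.\<close>
  define D where "D = 2 * B / \<eta> + 3"
  have D: "D > 0" using B0 \<eta> by (simp add: D_def add_nonneg_pos)
  have main: "real (card A) ^ K \<le> D ^ n * (real L ^ n) ^ K" for K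
  proof -
    let ?Ls = "{as. set as \<subseteq> A \<and> length as = K}"
    define \<phi> where "\<phi> as = (\<lambda>j\<in>{..<n}. \<lfloor>c j (expansion L x as) / \<eta>\<rfloor>)" for as
    define T where "T = \<lceil>B * real L ^ K / \<eta>\<rceil>"
    have T1: "B * real L ^ K / \<eta> \<le> of_int T" unfolding T_def by (rule le_of_int_ceiling)
    moreover have "0 \<le> B * real L ^ K / \<eta>" using B0 \<eta> by simp
    ultimately have T0: "T \<ge> 0" by linarith
    have "inj_on \<phi> ?Ls"
    proof (rule inj_onI, rule ccontr)
      fix as bs assume as: "as \<in> ?Ls" and bs: "bs \<in> ?Ls" and eq: "\<phi> as = \<phi> bs" and ne: "as \<noteq> bs"
      define y where "y i = expansion L x as i - expansion L x bs i" for i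
      \<comment> \<open>\<open>v\<close> is the kernel part of \<open>y\<close>, so separation
        applies to \<open>y - v\<close>. This is the combination of the \<open>u j\<close> with
        coefficients \<open>c j y\<close>, which a shared grid cell makes too small.\<close>
      define v where "v i = y i - (\<Sum>j<n. c j y * u j i)" for i
      have "\<delta> \<le> N (\<lambda>i. expansion L x as i - expansion L x bs i - v i)"
        by (rule expansion_separated[of N n f L A x \<delta>])
          (use N f L diam sep as bs ne cu in \<open>simp_all add: v_def[abs_def]\<close>)
      also have "(\<lambda>i. expansion L x as i - expansion L x bs i - v i) = (\<lambda>i. \<Sum>j<n. c j y * u j i)"
        by (simp add: v_def y_def)
      also have "N \<dots> \<le> (\<Sum>j<n. \<bar>c j y\<bar> * N (u j))"
        by (rule seminorm_sum_le[OF N])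
      also have "\<dots> \<le> (\<Sum>j<n. \<eta> * N (u j))"
      proof (intro sum_mono mult_right_mono seminorm_nonneg[OF N])
        fix j assume j: "j \<in> {..<n}"
        have "\<lfloor>c j (expansion L x as) / \<eta>\<rfloor> = \<lfloor>c j (expansion L x bs) / \<eta>\<rfloor>"
          using fun_cong[OF eq, of j] j by (simp add: \<phi>_def)
        then have "\<bar>c j (expansion L x as) / \<eta> - c j (expansion L x bs) / \<eta>\<bar> \<le> 1"
          by linarith
        then have "\<bar>(c j (expansion L x as) - c j (expansion L x bs)) / \<eta>\<bar> \<le> 1"
          by (simp add: diff_divide_distrib)
        moreover have "c j y = c j (expansion L x as) - c j (expansion L x bs)"
          using lin_fun_diff[OF c, of j] j unfolding y_def by simp
        ultimately show "\<bar>c j y\<bar> \<le> \<eta>"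
          using \<eta> by (simp add: abs_divide)
      qed
      also have "\<dots> = \<eta> * (W - 1)" by (simp add: W_def sum_distrib_left)
      also have "\<dots> < \<delta>" using W \<delta> by (simp add: \<eta>_def field_simps)
      finally show False by simp
    qed
    moreover have "\<phi> as \<in> PiE {..<n} (\<lambda>_. {-T..T})" if as: "as \<in> ?Ls" for as
    proof (rule PiE_I)
      fix j assume "j \<in> {..<n}"
      then have j: "j < n" by simp
      have "\<bar>c j (expansion L x as)\<bar> \<le> B * (real L ^ length as - 1)"
        by (rule expansion_functional_bound[of _ _ A]) (use c[OF j] L B[OF _ j] B0 as in auto)
      also have "\<dots> \<le> B * real L ^ K" using B0 as by (simp add: mult_left_mono)
      finally have "\<bar>c j (expansion L x as)\<bar> / \<eta> \<le> B * real L ^ K / \<eta>"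
        using \<eta> by (simp add: divide_right_mono)
      then have "\<bar>c j (expansion L x as) / \<eta>\<bar> \<le> of_int T"
        using \<eta> T1 by (simp add: abs_divide)
      then have "\<lfloor>c j (expansion L x as) / \<eta>\<rfloor> \<in> {-T..T}"
        unfolding atLeastAtMost_iff by linarith
      then show "\<phi> as j \<in> {-T..T}" using j by (simp add: \<phi>_def)
    qed (simp add: \<phi>_def)
    then have "\<phi> ` ?Ls \<subseteq> PiE {..<n} (\<lambda>_. {-T..T})" by (rule image_subsetI)
    ultimately have "card ?Ls \<le> card (PiE {..<n} (\<lambda>_. {-T..T}))"
      by (intro card_inj_on_le) (auto intro: finite_PiE)
    then have "card A ^ K \<le> nat (2 * T + 1) ^ n"
      using card_lists_length_eq[OF A, of K] T0 by (simp add: card_PiE)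
    then have "real (card A) ^ K \<le> real (nat (2 * T + 1)) ^ n"
      by (metis of_nat_le_iff of_nat_power)
    also have "\<dots> \<le> (D * real L ^ K) ^ n"
    proof (rule power_mono)
      have "real (nat (2 * T + 1)) = 2 * of_int T + 1" using T0 by simp
      also have "\<dots> \<le> 2 * (B * real L ^ K / \<eta>) + 3" unfolding T_def by linarith
      also have "\<dots> \<le> 2 * (B * real L ^ K / \<eta>) + 3 * real L ^ K" using L by simp
      also have "\<dots> = D * real L ^ K" by (simp add: D_def algebra_simps)
      finally show "real (nat (2 * T + 1)) \<le> D * real L ^ K" .
    qed simp
    also have "\<dots> = D ^ n * (real L ^ n) ^ K"
      by (simp add: power_mult_distrib flip: power_mult) (simp add: mult.commute)
    finally show ?thesis .
  qed
  show ?thesis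
  proof (rule ccontr)
    assume "\<not> card A \<le> L ^ n"
    then have "real L ^ n < real (card A)"
      by (metis not_le of_nat_less_iff of_nat_power)
    moreover have Lp: "real L ^ n > 0" using L by simp
    ultimately have "1 < real (card A) / real L ^ n" by simp
    then obtain K where "D ^ n < (real (card A) / real L ^ n) ^ K"
      using real_arch_pow by blast
    then have "D ^ n * (real L ^ n) ^ K < real (card A) ^ K"
      using Lp by (simp add: power_divide pos_less_divide_eq)
    then show False using main[of K] by simp
  qed
qed

subsection \<open>Sets with small pairwise intersections\<close>

text \<open>The Gilbert-Varshamov argument: \<open>E\<close> means too close, and by maximality the
  balls around a maximal family without close pairs cover \<open>\<Omega>\<close>.\<close>

lemma maximal_separated_subset:
  fixes E :: "'a \<Rightarrow> 'a \<Rightarrow> bool"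
  assumes "finite \<Omega>" and refl: "\<And>a. a \<in> \<Omega> \<Longrightarrow> E a a" and sym: "\<And>a b. E a b \<Longrightarrow> E b a"
    and ball: "\<And>a. a \<in> \<Omega> \<Longrightarrow> card {b \<in> \<Omega>. E a b} \<le> m"
  shows "\<exists>F\<subseteq>\<Omega>. (\<forall>a\<in>F. \<forall>b\<in>F. a \<noteq> b \<longrightarrow> \<not> E a b) \<and> card \<Omega> \<le> card F * m"
proof -
  let ?S = "{F. F \<subseteq> \<Omega> \<and> (\<forall>a\<in>F. \<forall>b\<in>F. a \<noteq> b \<longrightarrow> \<not> E a b)}"
  have "finite ?S" using assms(1) by simp
  moreover have "{} \<in> ?S" by simp
  ultimately have "\<exists>F\<in>?S. \<forall>F'\<in>?S. F \<subseteq> F' \<longrightarrow> F = F'"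
    using finite_has_maximal[of ?S] by blast
  then obtain F where F: "F \<in> ?S" and max: "\<forall>F'\<in>?S. F \<subseteq> F' \<longrightarrow> F = F'"
    by (rule bexE)
  have "\<Omega> \<subseteq> (\<Union>a\<in>F. {b \<in> \<Omega>. E a b})"
  proof
    fix b assume b: "b \<in> \<Omega>"
    show "b \<in> (\<Union>a\<in>F. {b \<in> \<Omega>. E a b})"
    proof (rule ccontr)
      assume n: "b \<notin> (\<Union>a\<in>F. {b \<in> \<Omega>. E a b})"
      then have "insert b F \<in> ?S" using F b sym by auto
      then have "F = insert b F" using bspec[OF max] by blast
      then have "b \<in> F" by blast
      then show False using n b refl by auto
    qed
  qed
  then have "card \<Omega> \<le> card (\<Union>a\<in>F. {b \<in> \<Omega>. E a b})"
    using F assms(1) by (intro card_mono) (auto intro: finite_subset)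
  also have "\<dots> \<le> (\<Sum>a\<in>F. card {b \<in> \<Omega>. E a b})"
    using F assms(1) by (intro card_UN_le) (auto intro: finite_subset)
  also have "\<dots> \<le> card F * m"
    using F ball by (intro sum_bounded_above[of F _ m, simplified]) auto
  finally show ?thesis using F by blast
qed

text \<open>Gilbert-Varshamov for words of length \<open>t\<close> over \<open>q\<close> letters. A
  word close to \<open>g\<close> is found by choosing where it agrees with \<open>g\<close>, in at
  most \<open>2 ^ t\<close> ways, and filling the at most \<open>t div 2\<close> remaining
  places.\<close>

lemma code_with_few_agreements:
  fixes t q :: nat
  assumes q: "q \<ge> 1"
  shows "\<exists>F \<subseteq> {..<t} \<rightarrow>\<^sub>E {..<q}. (\<forall>g\<in>F. \<forall>h\<in>F. g \<noteq> h \<longrightarrow> 2 * card {l\<in>{..<t}. g l = h l} < t) \<and>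
    q ^ t \<le> 4 ^ t * card F ^ 2"
proof (cases "t = 0")
  case True
  then show ?thesis by (intro exI[of _ "{\<lambda>_. undefined}"]) auto
next
  case t: False
  define \<Omega> where "\<Omega> = ({..<t} \<rightarrow>\<^sub>E {..<q})"
  define E where "E g h \<longleftrightarrow> t \<le> 2 * card {l\<in>{..<t}. g l = h l}" for g h :: "nat \<Rightarrow> nat"
  have fin: "finite \<Omega>" by (auto simp: \<Omega>_def intro: finite_PiE)
  have c\<Omega>: "card \<Omega> = q ^ t" by (simp add: \<Omega>_def card_PiE)
  have ball: "card {h \<in> \<Omega>. E g h} \<le> 2 ^ t * q ^ (t div 2)" if "g \<in> \<Omega>" for g
  proof -
    let ?T = "{T. T \<subseteq> {..<t} \<and> t \<le> 2 * card T}"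
    \<comment> \<open>Letters off \<open>T\<close> are left free rather than forced to differ from
      \<open>g\<close>; the overcount is harmless in an upper bound.\<close>
    let ?H = "\<lambda>T. PiE {..<t} (\<lambda>l. if l \<in> T then {g l} else {..<q})"
    have finT: "finite ?T" by (rule finite_subset[of _ "Pow {..<t}"]) auto
    have "{h \<in> \<Omega>. E g h} \<subseteq> (\<Union>T\<in>?T. ?H T)"
    proof
      fix h assume h: "h \<in> {h \<in> \<Omega>. E g h}"
      then show "h \<in> (\<Union>T\<in>?T. ?H T)"
        by (intro UN_I[of "{l\<in>{..<t}. g l = h l}"]) (auto simp: \<Omega>_def E_def PiE_iff)
    qed
    then have "card {h \<in> \<Omega>. E g h} \<le> card (\<Union>T\<in>?T. ?H T)"
      using finT by (intro card_mono) (auto intro!: finite_PiE)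
    also have "\<dots> \<le> (\<Sum>T\<in>?T. card (?H T))" using finT by (rule card_UN_le)
    also have "\<dots> \<le> (\<Sum>T\<in>?T. q ^ (t div 2))"
    proof (rule sum_mono)
      fix T assume T: "T \<in> ?T"
      have "card (?H T) = (\<Prod>l<t. if l \<in> T then 1 else q)"
        by (simp add: card_PiE if_distrib cong: if_cong)
      also have "\<dots> = (\<Prod>l\<in>{..<t} - T. q)"
        by (rule prod.mono_neutral_cong_right) auto
      also have "\<dots> = q ^ (t - card T)" using T
        using card_Diff_subset[of T "{..<t}"] finite_subset[of T "{..<t}"] by auto
      also have "\<dots> \<le> q ^ (t div 2)" using T q by (intro power_increasing) auto
      finally show "card (?H T) \<le> q ^ (t div 2)" .
    qed
    also have "\<dots> = card ?T * q ^ (t div 2)" by simp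
    also have "\<dots> \<le> card (Pow {..<t}) * q ^ (t div 2)"
      by (intro mult_right_mono card_mono) auto
    also have "\<dots> = 2 ^ t * q ^ (t div 2)" by (simp add: card_Pow)
    finally show ?thesis .
  qed
  have "E g g" for g by (simp add: E_def)
  moreover have "E h g" if "E g h" for g h
    using that by (simp add: E_def eq_commute[of "h _"])
  ultimately obtain F where F: "F \<subseteq> \<Omega>" "\<forall>a\<in>F. \<forall>b\<in>F. a \<noteq> b \<longrightarrow> \<not> E a b"
    and card: "card \<Omega> \<le> card F * (2 ^ t * q ^ (t div 2))"
    using maximal_separated_subset[of \<Omega> E "2 ^ t * q ^ (t div 2)", OF fin _ _ ball] by blast
  \<comment> \<open>Squaring avoids half-integer exponents: \<open>2 * (t div 2) \<le> t\<close>
    holds for either parity, and one factor \<open>q ^ t\<close> then cancels.\<close>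
  have "q ^ t * q ^ t = card \<Omega> ^ 2" by (simp add: c\<Omega> power2_eq_square)
  also have "\<dots> \<le> (card F * (2 ^ t * q ^ (t div 2))) ^ 2" using card by (intro power_mono) auto
  also have "\<dots> = 4 ^ t * card F ^ 2 * q ^ (2 * (t div 2))"
  proof -
    have "((2::nat) ^ t) ^ 2 = 4 ^ t" by (simp add: power_mult[symmetric] mult.commute[of t]) (simp add: power_mult)
    moreover have "(q ^ (t div 2)) ^ 2 = q ^ (2 * (t div 2))" by (simp add: power_mult[symmetric] mult.commute)
    ultimately show ?thesis by (simp only: power_mult_distrib ac_simps)
  qed
  also have "\<dots> \<le> 4 ^ t * card F ^ 2 * q ^ t"
    using q by (intro mult_left_mono power_increasing) auto
  finally have "q ^ t \<le> 4 ^ t * card F ^ 2" using q by simp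
  then show ?thesis using F by (intro exI[of _ F]) (auto simp: \<Omega>_def E_def not_le)
qed

text \<open>A \<open>t\<close> by \<open>q\<close> grid is embedded in \<open>U\<close> and each
  code word is replaced by the image of its graph. Graphs have exactly \<open>t\<close> points and
  meet where the words agree.\<close>

lemma family_with_small_intersections:
  fixes U :: "'a set" and t q :: nat
  assumes U: "finite U" "t * q \<le> card U" and q: "q \<ge> 1"
  shows "\<exists>F. finite F \<and> (\<forall>S\<in>F. S \<subseteq> U \<and> card S = t) \<and>
    (\<forall>S\<in>F. \<forall>T\<in>F. S \<noteq> T \<longrightarrow> 2 * card (S \<inter> T) < t) \<and> q ^ t \<le> 4 ^ t * card F ^ 2"
proof -
  have "card ({..<t} \<times> {..<q}) \<le> card U" using U by simp
  then obtain \<phi> where \<phi>: "\<phi> ` ({..<t} \<times> {..<q}) \<subseteq> U" "inj_on \<phi> ({..<t} \<times> {..<q})"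
    using card_le_inj[of "{..<t} \<times> {..<q}" U] U(1) by blast
  obtain F where F: "F \<subseteq> {..<t} \<rightarrow>\<^sub>E {..<q}"
    and Fd: "\<And>g h. g \<in> F \<Longrightarrow> h \<in> F \<Longrightarrow> g \<noteq> h \<Longrightarrow> 2 * card {l\<in>{..<t}. g l = h l} < t"
    and Fc: "q ^ t \<le> 4 ^ t * card F ^ 2"
    using code_with_few_agreements[OF q, of t] by blast
  define S where "S g = (\<lambda>l. \<phi> (l, g l)) ` {..<t}" for g
  have rng: "g l < q" if "g \<in> F" "l < t" for g l using F that by (auto simp: PiE_iff subset_iff)
  have inj1: "inj_on (\<lambda>l. \<phi> (l, g l)) {..<t}" if "g \<in> F" for g
    using rng[OF that] by (intro inj_onI) (use inj_onD[OF \<phi>(2)] in fastforce)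
  have cS: "card (S g) = t" if "g \<in> F" for g
    using card_image[OF inj1[OF that]] by (simp add: S_def)
  have int: "S g \<inter> S h = (\<lambda>l. \<phi> (l, g l)) ` {l\<in>{..<t}. g l = h l}" if "g \<in> F" "h \<in> F" for g h
  proof
    show "S g \<inter> S h \<subseteq> (\<lambda>l. \<phi> (l, g l)) ` {l\<in>{..<t}. g l = h l}"
    proof
      fix i assume "i \<in> S g \<inter> S h"
      then obtain l m where lm: "l < t" "m < t" "i = \<phi> (l, g l)" "i = \<phi> (m, h m)"
        by (auto simp: S_def)
      then have "(l, g l) = (m, h m)"
        by (intro inj_onD[OF \<phi>(2)]) (use rng that in auto)
      then have "g l = h l" by auto
      then show "i \<in> (\<lambda>l. \<phi> (l, g l)) ` {l\<in>{..<t}. g l = h l}"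
        using lm(1,3) by (intro image_eqI[of _ _ l]) simp_all
    qed
    show "(\<lambda>l. \<phi> (l, g l)) ` {l\<in>{..<t}. g l = h l} \<subseteq> S g \<inter> S h"
    proof (rule image_subsetI)
      fix l assume "l \<in> {l\<in>{..<t}. g l = h l}"
      then have "l \<in> {..<t}" "\<phi> (l, g l) = \<phi> (l, h l)" by auto
      then show "\<phi> (l, g l) \<in> S g \<inter> S h" unfolding S_def by blast
    qed
  qed
  have cint: "card (S g \<inter> S h) \<le> card {l\<in>{..<t}. g l = h l}" if "g \<in> F" "h \<in> F" for g h
    unfolding int[OF that] by (rule card_image_le) simp
  have "inj_on S F"
  proof (rule inj_onI, rule ccontr)
    fix g h assume gh: "g \<in> F" "h \<in> F" "S g = S h" "g \<noteq> h"
    then show False using cint[of g h] Fd[of g h] cS[of h] by simp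
  qed
  then have "card (S ` F) = card F" by (rule card_image)
  moreover have "finite F" using F by (rule finite_subset) (auto intro: finite_PiE)
  moreover have "S g \<subseteq> U" if "g \<in> F" for g using \<phi>(1) rng[OF that] by (auto simp: S_def)
  moreover have "2 * card (S g \<inter> S h) < t" if "g \<in> F" "h \<in> F" "S g \<noteq> S h" for g h
    using cint[of g h] Fd[of g h] that by fastforce
  ultimately show ?thesis using Fc cS by (intro exI[of _ "S ` F"]) auto
qed

text \<open>Common interface for the two terms of the lower bound. Taking logarithms in
  \<open>q ^ t \<le> 4 ^ t * (L ^ n) ^ 2\<close> produces the division by 4 and the factor
  2.\<close>

lemma sparse_packing_bound:
  fixes U :: "nat set" and t q L n :: nat
  assumes N: "seminorm N" and f: "\<And>k. k < n \<Longrightarrow> lin_fun (f k)" and L: "L \<ge> 2" and \<delta>: "\<delta> > 0"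
    and U: "finite U" "t * q \<le> card U" and q: "q \<ge> 1"
    and diam: "\<And>S T. S \<subseteq> U \<Longrightarrow> T \<subseteq> U \<Longrightarrow> card S = t \<Longrightarrow> card T = t \<Longrightarrow>
      N (\<lambda>i. of_bool (i \<in> S) - of_bool (i \<in> T)) \<le> (real L - 1) * \<delta>"
    and sep: "\<And>S T v. S \<subseteq> U \<Longrightarrow> T \<subseteq> U \<Longrightarrow> card S = t \<Longrightarrow> card T = t \<Longrightarrow> 2 * card (S \<inter> T) < t \<Longrightarrow>
      (\<And>k. k < n \<Longrightarrow> f k v = 0) \<Longrightarrow> \<delta> \<le> N (\<lambda>i. of_bool (i \<in> S) - of_bool (i \<in> T) - v i)"
  shows "real t * ln (real q / 4) \<le> 2 * real n * ln (real L)"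
proof -
  obtain F where F: "finite F" "\<forall>S\<in>F. S \<subseteq> U \<and> card S = t"
    and Fd: "\<forall>S\<in>F. \<forall>T\<in>F. S \<noteq> T \<longrightarrow> 2 * card (S \<inter> T) < t"
    and Fc: "q ^ t \<le> 4 ^ t * card F ^ 2"
    using family_with_small_intersections[OF U q] by (elim exE conjE)
  have "card F \<le> L ^ n"
  proof (rule packing_bound[where N = N and f = f and \<delta> = \<delta> and x = "\<lambda>S i. of_bool (i \<in> S)"])
    show "lin_fun (f k)" if "k < n" for k using f[OF that] .
  next
    fix S T assume "S \<in> F" "T \<in> F"
    then show "N (\<lambda>i. of_bool (i \<in> S) - of_bool (i \<in> T)) \<le> (real L - 1) * \<delta>"
      using F(2) by (intro diam) auto
  next
    fix S T v assume "S \<in> F" "T \<in> F" "S \<noteq> T" and v: "\<And>k. k < n \<Longrightarrow> f k v = 0"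
    then show "\<delta> \<le> N (\<lambda>i. of_bool (i \<in> S) - of_bool (i \<in> T) - v i)"
      using F(2) Fd by (intro sep v) auto
  qed (use N L \<delta> F in auto)
  then have "4 ^ t * card F ^ 2 \<le> 4 ^ t * (L ^ n) ^ 2"
    by (intro mult_left_mono power_mono) auto
  then have "q ^ t \<le> 4 ^ t * (L ^ n) ^ 2" using Fc by (rule order_trans[rotated])
  then have "real (q ^ t) \<le> real (4 ^ t * (L ^ n) ^ 2)" by (rule of_nat_mono)
  then have "real q ^ t \<le> 4 ^ t * (real L ^ n) ^ 2" by simp
  then have "(real q / 4) ^ t \<le> (real L ^ n) ^ 2" by (simp add: power_divide field_simps)
  then have "ln ((real q / 4) ^ t) \<le> ln ((real L ^ n) ^ 2)"
    using q L by (subst ln_le_cancel_iff) auto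
  then show ?thesis using q L by (simp add: ln_realpow)
qed

subsection \<open>The mixed norm and sparse vectors\<close>

text \<open>The right-hand side of the recovery bound without \<open>C\<close>, for functions in
  place of vectors.\<close>

definition mixed_norm :: "nat \<Rightarrow> nat \<Rightarrow> nat set \<Rightarrow> nat set set \<Rightarrow> (nat \<Rightarrow> real) \<Rightarrow> real" where
  "mixed_norm s sg I P x = (\<Sum>i\<in>I. \<bar>x i\<bar>) / sqrt (real s) + (\<Sum>G\<in>P. L2_set x G) / sqrt (real sg)"

lemma L2_set_scale: "L2_set (\<lambda>i. c * x i) G = \<bar>c\<bar> * L2_set x G"
  by (simp add: L2_set_def power_mult_distrib real_sqrt_mult flip: sum_distrib_left)

lemma seminorm_mixed_norm: "seminorm (mixed_norm s sg I P)"
  unfolding seminorm_def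
proof (intro conjI allI)
  fix x y :: "nat \<Rightarrow> real"
  have "(\<Sum>i\<in>I. \<bar>x i + y i\<bar>) \<le> (\<Sum>i\<in>I. \<bar>x i\<bar>) + (\<Sum>i\<in>I. \<bar>y i\<bar>)"
    unfolding sum.distrib[symmetric] by (intro sum_mono abs_triangle_ineq)
  moreover have "(\<Sum>G\<in>P. L2_set (\<lambda>i. x i + y i) G) \<le> (\<Sum>G\<in>P. L2_set x G) + (\<Sum>G\<in>P. L2_set y G)"
    unfolding sum.distrib[symmetric] by (intro sum_mono L2_set_triangle_ineq)
  ultimately have "mixed_norm s sg I P (\<lambda>i. x i + y i)
      \<le> ((\<Sum>i\<in>I. \<bar>x i\<bar>) + (\<Sum>i\<in>I. \<bar>y i\<bar>)) / sqrt (real s)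
        + ((\<Sum>G\<in>P. L2_set x G) + (\<Sum>G\<in>P. L2_set y G)) / sqrt (real sg)"
    unfolding mixed_norm_def by (intro add_mono divide_right_mono) auto
  then show "mixed_norm s sg I P (\<lambda>i. x i + y i) \<le> mixed_norm s sg I P x + mixed_norm s sg I P y"
    by (simp add: mixed_norm_def add_divide_distrib)
next
  fix c and x :: "nat \<Rightarrow> real"
  show "mixed_norm s sg I P (\<lambda>i. c * x i) = \<bar>c\<bar> * mixed_norm s sg I P x"
    by (simp add: mixed_norm_def L2_set_scale abs_mult algebra_simps flip: sum_distrib_left)
qed

section \<open>Cauchy-Schwarz on entries and on groups\<close>

lemma sum_le_sqrt_card_L2_set: "(\<Sum>i\<in>A. \<bar>x i\<bar>) \<le> sqrt (real (card A)) * L2_set x A"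
proof -
  have "(\<Sum>i\<in>A. \<bar>1 :: real\<bar> * \<bar>x i\<bar>) \<le> L2_set (\<lambda>_. 1) A * L2_set x A"
    by (rule L2_set_mult_ineq)
  then show ?thesis by (simp add: L2_set_def)
qed

lemma L2_set_subset: "finite B \<Longrightarrow> A \<subseteq> B \<Longrightarrow> L2_set x A \<le> L2_set x B"
  unfolding L2_set_def by (intro real_sqrt_le_mono sum_mono2) auto

text \<open>Cauchy-Schwarz over the chosen groups; by disjointness their squared norms add up to the
  squared norm on the union.\<close>

lemma sum_L2_set_le:
  assumes P: "partition_on I P" "finite I" and Q: "Q \<subseteq> P"
  shows "(\<Sum>G\<in>Q. L2_set x G) \<le> sqrt (real (card Q)) * L2_set x I"
proof -
  have fin: "finite G" if "G \<in> P" for G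
    using partition_onD1[OF P(1)] P(2) that finite_subset[of G I] by blast
  have "(\<Sum>G\<in>Q. L2_set x G) = (\<Sum>G\<in>Q. \<bar>L2_set x G\<bar>)" by simp
  also have "\<dots> \<le> sqrt (real (card Q)) * L2_set (L2_set x) Q" by (rule sum_le_sqrt_card_L2_set)
  also have "L2_set (L2_set x) Q = L2_set x (\<Union>Q)"
  proof -
    have "(\<Sum>G\<in>Q. (L2_set x G)\<^sup>2) = (\<Sum>G\<in>Q. \<Sum>i\<in>G. (x i)\<^sup>2)"
      by (simp add: L2_set_def sum_nonneg)
    also have "\<dots> = (\<Sum>i\<in>\<Union>Q. (x i)\<^sup>2)"
      using partition_onD2[OF P(1)] fin Q
      by (subst sum.Union_disjoint) (auto simp: disjoint_def)
    finally show ?thesis by (simp add: L2_set_def)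
  qed
  also have "sqrt (real (card Q)) * L2_set x (\<Union>Q) \<le> sqrt (real (card Q)) * L2_set x I"
    using P Q by (intro mult_left_mono L2_set_subset) (auto simp: partition_on_def)
  finally show ?thesis .
qed

text \<open>Abstract support splitting, applied once with single entries as blocks and once with
  groups. There \<open>\<alpha>\<close>, \<open>\<beta>\<close>, \<open>\<gamma>\<close> are the
  sizes of \<open>x\<close>, \<open>v\<close> and \<open>x - v\<close> on a block, and
  \<open>x\<close> vanishes off \<open>Q\<close>.\<close>

lemma sum_block_ge:
  fixes \<alpha> \<beta> \<gamma> :: "'a \<Rightarrow> real"
  assumes "finite P" "Q \<subseteq> P" "\<And>G. G \<in> Q \<Longrightarrow> \<alpha> G \<le> \<gamma> G + \<beta> G"
    and "\<And>G. G \<in> P \<Longrightarrow> G \<notin> Q \<Longrightarrow> \<alpha> G + \<beta> G \<le> \<gamma> G"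
  shows "sum \<alpha> P + sum \<beta> P - 2 * sum \<beta> Q \<le> sum \<gamma> P"
proof -
  have split: "sum h P = sum h (P - Q) + sum h Q" for h :: "'a \<Rightarrow> real"
    using sum.subset_diff[OF assms(2,1)] .
  have "sum \<alpha> Q \<le> sum \<gamma> Q + sum \<beta> Q"
    unfolding sum.distrib[symmetric] using assms(3) by (intro sum_mono) auto
  moreover have "sum \<alpha> (P - Q) + sum \<beta> (P - Q) \<le> sum \<gamma> (P - Q)"
    unfolding sum.distrib[symmetric] using assms(4) by (intro sum_mono) auto
  ultimately show ?thesis unfolding split[of \<alpha>] split[of \<beta>] split[of \<gamma>] by simp
qed

text \<open>Subtracting \<open>v\<close> gains the mass of \<open>v\<close> off the support of
  \<open>x\<close> and loses at most its mass on it. By Cauchy-Schwarz and the kernel bound the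
  latter is at most half of the total, so the balance is nonnegative.\<close>

lemma sparse_minimal_in_coset:
  fixes C :: real
  assumes P: "partition_on I P" "finite I"
    and s: "s \<ge> 1" "sg \<ge> 1" and C: "C > 0"
    and v: "L2_set v I \<le> C * mixed_norm s sg I P v"
    and S: "S \<subseteq> I" "card S \<le> \<sigma>" and Q: "Q \<subseteq> P" "card Q \<le> \<tau>" "S \<subseteq> \<Union>Q"
    and x: "\<And>i. i \<notin> S \<Longrightarrow> x i = 0"
    and small: "C * (sqrt (real \<sigma> / real s) + sqrt (real \<tau> / real sg)) \<le> 1 / 2"
  shows "mixed_norm s sg I P x \<le> mixed_norm s sg I P (\<lambda>i. x i - v i)"
proof -
  let ?N = "mixed_norm s sg I P"
  have finP: "finite P" using finite_elements[OF P(2,1)] .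
  have "(\<Sum>i\<in>S. \<bar>v i\<bar>) \<le> sqrt (real (card S)) * L2_set v S" by (rule sum_le_sqrt_card_L2_set)
  also have "\<dots> \<le> sqrt (real \<sigma>) * L2_set v I"
    using S P by (intro mult_mono L2_set_subset) auto
  finally have vS: "(\<Sum>i\<in>S. \<bar>v i\<bar>) \<le> sqrt (real \<sigma>) * L2_set v I" .
  have "(\<Sum>G\<in>Q. L2_set v G) \<le> sqrt (real (card Q)) * L2_set v I" by (rule sum_L2_set_le[OF P Q(1)])
  also have "\<dots> \<le> sqrt (real \<tau>) * L2_set v I"
    using Q by (intro mult_right_mono) auto
  finally have vQ: "(\<Sum>G\<in>Q. L2_set v G) \<le> sqrt (real \<tau>) * L2_set v I" .
  have l1: "(\<Sum>i\<in>I. \<bar>x i\<bar>) + (\<Sum>i\<in>I. \<bar>v i\<bar>) - 2 * (\<Sum>i\<in>S. \<bar>v i\<bar>) \<le> (\<Sum>i\<in>I. \<bar>x i - v i\<bar>)"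
    by (rule sum_block_ge) (use P S x in auto)
  have l2: "(\<Sum>G\<in>P. L2_set x G) + (\<Sum>G\<in>P. L2_set v G) - 2 * (\<Sum>G\<in>Q. L2_set v G)
      \<le> (\<Sum>G\<in>P. L2_set (\<lambda>i. x i - v i) G)"
  proof (rule sum_block_ge[OF finP Q(1)])
    fix G
    show "L2_set x G \<le> L2_set (\<lambda>i. x i - v i) G + L2_set v G"
      using L2_set_triangle_ineq[of "\<lambda>i. x i - v i" v G] by simp
  next
    fix G assume G: "G \<in> P" "G \<notin> Q"
    have x0: "x i = 0" if "i \<in> G" for i
    proof (rule x)
      show "i \<notin> S"
      proof
        assume "i \<in> S"
        then obtain G' where "G' \<in> Q" "i \<in> G'" using Q by blast
        moreover from this have "G' \<in> P" "G' \<noteq> G" using G Q(1) by auto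
        ultimately show False using disjointD[OF partition_onD2[OF P(1)], of G' G] G that by auto
      qed
    qed
    have "L2_set x G = 0" using x0 by (simp add: L2_set_def)
    moreover have "L2_set (\<lambda>i. x i - v i) G = L2_set v G"
      using x0 by (simp add: L2_set_def)
    ultimately show "L2_set x G + L2_set v G \<le> L2_set (\<lambda>i. x i - v i) G" by simp
  qed
  have "?N x + ?N v - 2 * ((\<Sum>i\<in>S. \<bar>v i\<bar>) / sqrt (real s) + (\<Sum>G\<in>Q. L2_set v G) / sqrt (real sg))
     = ((\<Sum>i\<in>I. \<bar>x i\<bar>) + (\<Sum>i\<in>I. \<bar>v i\<bar>) - 2 * (\<Sum>i\<in>S. \<bar>v i\<bar>)) / sqrt (real s)
       + ((\<Sum>G\<in>P. L2_set x G) + (\<Sum>G\<in>P. L2_set v G) - 2 * (\<Sum>G\<in>Q. L2_set v G)) / sqrt (real sg)"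
    by (simp add: mixed_norm_def add_divide_distrib diff_divide_distrib)
  also have "\<dots> \<le> ?N (\<lambda>i. x i - v i)"
    unfolding mixed_norm_def using l1 l2 by (intro add_mono divide_right_mono) auto
  finally have main: "?N x + ?N v
      - 2 * ((\<Sum>i\<in>S. \<bar>v i\<bar>) / sqrt (real s) + (\<Sum>G\<in>Q. L2_set v G) / sqrt (real sg))
      \<le> ?N (\<lambda>i. x i - v i)" .
  have "(\<Sum>i\<in>S. \<bar>v i\<bar>) / sqrt (real s) + (\<Sum>G\<in>Q. L2_set v G) / sqrt (real sg)
      \<le> sqrt (real \<sigma>) * L2_set v I / sqrt (real s) + sqrt (real \<tau>) * L2_set v I / sqrt (real sg)"
    using vS vQ by (intro add_mono divide_right_mono) auto
  also have "\<dots> = L2_set v I * (sqrt (real \<sigma> / real s) + sqrt (real \<tau> / real sg))"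
    by (simp add: real_sqrt_divide algebra_simps)
  also have "\<dots> \<le> (C * ?N v) * (sqrt (real \<sigma> / real s) + sqrt (real \<tau> / real sg))"
    using v by (intro mult_right_mono) auto
  also have "\<dots> = ?N v * (C * (sqrt (real \<sigma> / real s) + sqrt (real \<tau> / real sg)))" by simp
  also have "\<dots> \<le> ?N v * (1 / 2)"
    using small by (intro mult_left_mono seminorm_nonneg[OF seminorm_mixed_norm]) auto
  finally show ?thesis using main by simp
qed

section \<open>Sparse indicator vectors and the two packings\<close>

lemma sum_abs_diff_of_bool:
  fixes S T :: "'a set"
  assumes "finite I" "S \<subseteq> I" "T \<subseteq> I" "card S = t" "card T = t"
  shows "(\<Sum>i\<in>I. \<bar>of_bool (i \<in> S) - of_bool (i \<in> T) :: real\<bar>) = 2 * real t - 2 * real (card (S \<inter> T))"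
proof -
  have "(\<Sum>i\<in>I. \<bar>of_bool (i \<in> S) - of_bool (i \<in> T) :: real\<bar>)
      = (\<Sum>i\<in>I. of_bool (i \<in> S) + of_bool (i \<in> T) - 2 * of_bool (i \<in> S \<inter> T))"
    by (rule sum.cong) auto
  also have "\<dots> = real (card (I \<inter> S)) + real (card (I \<inter> T)) - 2 * real (card (I \<inter> (S \<inter> T)))"
    using assms(1) by (simp add: sum.distrib sum_subtractf sum_distrib_left[symmetric]
        sum.If_cases of_bool_def Int_def)
  also have "\<dots> = real (card S) + real (card T) - 2 * real (card (S \<inter> T))"
    using assms(2,3) by (simp add: Int_absorb1 le_infI1)
  finally show ?thesis using assms by simp
qed

text \<open>On a transversal each group holds at most one nonzero entry, so the two norms coincide
  and the mixed norm is \<open>\<rho>\<close> times the 1-norm. Differences of the chosen indicators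
  have at most \<open>2 * t\<close> nonzero entries, in at most \<open>2 * t\<close> groups.\<close>

lemma group_sparsity_bound:
  fixes C :: real
  assumes P: "partition_on I P" "finite I"
    and s: "s \<ge> 1" "sg \<ge> 1" and C: "C > 0"
    and f: "\<And>k. k < n \<Longrightarrow> lin_fun (f k)"
    and ker: "\<And>v. (\<And>k. k < n \<Longrightarrow> f k v = 0) \<Longrightarrow> L2_set v I \<le> C * mixed_norm s sg I P v"
    and t: "t \<ge> 1" "t \<le> card P"
    and small: "C * (sqrt (real (2 * t) / real s) + sqrt (real (2 * t) / real sg)) \<le> 1 / 2"
  shows "real t * ln (real (card P div t) / 4) \<le> 2 * real n * ln 32"
proof -
  let ?N = "mixed_norm s sg I P"
  define r where "r G = (SOME i. i \<in> G)" for G :: "nat set"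
  have r: "r G \<in> G" if "G \<in> P" for G
    using partition_onD3[OF P(1)] that unfolding r_def by (subst some_in_eq) auto
  have rinj: "inj_on r P"
  proof (rule inj_onI, rule ccontr)
    fix G H assume GH: "G \<in> P" "H \<in> P" "r G = r H" "G \<noteq> H"
    then have "r G \<in> G \<inter> H" using r[of G] r[of H] by simp
    then show False using disjointD[OF partition_onD2[OF P(1)] GH(1,2,4)] by simp
  qed
  define U where "U = r ` P"
  have finP: "finite P" using finite_elements[OF P(2,1)] .
  have UI: "U \<subseteq> I" using r partition_onD1[OF P(1)] by (auto simp: U_def)
  have finU: "finite U" using finite_subset[OF UI P(2)] .
  have cU: "card U = card P" using rinj by (simp add: U_def card_image)
  define \<rho> where "\<rho> = 1 / sqrt (real s) + 1 / sqrt (real sg)"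
  have \<rho>: "\<rho> > 0" using s by (simp add: \<rho>_def add_pos_pos)
  have Nx: "?N x = (\<Sum>i\<in>I. \<bar>x i\<bar>) * \<rho>" if x: "\<And>i. i \<notin> U \<Longrightarrow> x i = 0" for x
  proof -
    have fin: "finite G" if "G \<in> P" for G
      using partition_onD1[OF P(1)] P(2) that finite_subset[of G I] by blast
    have "(\<Sum>G\<in>P. L2_set x G) \<le> (\<Sum>G\<in>P. \<Sum>i\<in>G. \<bar>x i\<bar>)"
      by (intro sum_mono L2_set_le_sum_abs)
    also have "\<dots> = (\<Sum>i\<in>\<Union>P. \<bar>x i\<bar>)"
      using partition_onD2[OF P(1)] fin
      by (subst sum.Union_disjoint) (auto simp: disjoint_def)
    also have "\<dots> = (\<Sum>i\<in>I. \<bar>x i\<bar>)" using partition_onD1[OF P(1)] by simp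
    finally have le: "(\<Sum>G\<in>P. L2_set x G) \<le> (\<Sum>i\<in>I. \<bar>x i\<bar>)" .
    have "(\<Sum>i\<in>I. \<bar>x i\<bar>) = (\<Sum>i\<in>U. \<bar>x i\<bar>)"
      using UI P x by (intro sum.mono_neutral_right) auto
    also have "\<dots> = (\<Sum>G\<in>P. \<bar>x (r G)\<bar>)" using rinj by (simp add: U_def sum.reindex)
    also have "\<dots> \<le> (\<Sum>G\<in>P. L2_set x G)"
    proof (rule sum_mono)
      fix G assume G: "G \<in> P"
      have "\<bar>x (r G)\<bar> \<le> L2_set (\<lambda>i. \<bar>x i\<bar>) G"
        using member_le_L2_set[OF fin[OF G] r[OF G], of "\<lambda>i. \<bar>x i\<bar>"] by simp
      then show "\<bar>x (r G)\<bar> \<le> L2_set x G" by (simp add: L2_set_def)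
    qed
    finally show ?thesis using le by (simp add: mixed_norm_def \<rho>_def algebra_simps)
  qed
  have "real t * ln (real (card P div t) / 4) \<le> 2 * real n * ln (real 32)"
  proof (rule sparse_packing_bound[where N = ?N and f = f and U = U and \<delta> = "real t * \<rho>"])
    show "seminorm ?N" by (rule seminorm_mixed_norm)
    show "lin_fun (f k)" if "k < n" for k using f[OF that] .
    show "0 < real t * \<rho>" using t \<rho> by simp
    show "t * (card P div t) \<le> card U" by (simp add: cU)
    show "1 \<le> card P div t" using t by (simp add: div_greater_zero_iff Suc_le_eq)
  next
    fix S T assume ST: "S \<subseteq> U" "T \<subseteq> U" "card S = t" "card T = t"
    let ?x = "\<lambda>i. of_bool (i \<in> S) - of_bool (i \<in> T) :: real"
    have "?N ?x = (2 * real t - 2 * real (card (S \<inter> T))) * \<rho>"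
      using sum_abs_diff_of_bool[OF P(2), of S T t] ST UI by (subst Nx) auto
    \<comment> \<open>The distance is at most \<open>2 * t * \<rho>\<close>; the slack up to 31 lets
      both packings run with base 32.\<close>
    also have "\<dots> \<le> 31 * real t * \<rho>" using \<rho> by (intro mult_right_mono) auto
    finally show "?N ?x \<le> (real 32 - 1) * (real t * \<rho>)" by simp
  next
    fix S T v assume ST: "S \<subseteq> U" "T \<subseteq> U" "card S = t" "card T = t" "2 * card (S \<inter> T) < t"
      and v: "\<And>k. k < n \<Longrightarrow> f k v = 0"
    let ?x = "\<lambda>i. of_bool (i \<in> S) - of_bool (i \<in> T) :: real"
    let ?Q = "{G \<in> P. r G \<in> S \<union> T}"
    have "real t * \<rho> \<le> (2 * real t - 2 * real (card (S \<inter> T))) * \<rho>"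
      using ST \<rho> by (intro mult_right_mono) auto
    also have "\<dots> = ?N ?x"
      using sum_abs_diff_of_bool[OF P(2), of S T t] ST UI by (subst Nx) auto
    also have "\<dots> \<le> ?N (\<lambda>i. ?x i - v i)"
    proof (rule sparse_minimal_in_coset[OF P s C ker[OF v], where S = "S \<union> T" and Q = ?Q])
      show "S \<union> T \<subseteq> I" using ST UI by auto
      show c: "card (S \<union> T) \<le> 2 * t" using card_Un_le[of S T] ST by simp
      have "card ?Q = card (r ` ?Q)"
        using rinj by (intro card_image[symmetric] inj_on_subset[OF rinj]) auto
      also have "\<dots> \<le> card (S \<union> T)"
        using ST finU by (intro card_mono) (auto intro: finite_subset)
      finally show "card ?Q \<le> 2 * t" using c by simp
      show "S \<union> T \<subseteq> \<Union>?Q"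
      proof
        fix i assume i: "i \<in> S \<union> T"
        then obtain G where "G \<in> P" "i = r G" using ST by (auto simp: U_def)
        then show "i \<in> \<Union>?Q" using i r by auto
      qed
    qed (use small in auto)
    finally show "real t * \<rho> \<le> ?N (\<lambda>i. ?x i - v i)" .
  qed (use finU in auto)
  then show ?thesis by simp
qed

text \<open>All supports lie in the same \<open>\<tau>\<close> groups. Distances are bounded below
  by their 1-norm part alone. In the upper bound, in units of \<open>\<delta>\<close>, that part
  contributes 2 and the group part, through \<open>ratio\<close> and \<open>841 = 29 ^ 2\<close>,
  contributes 29; the sum is \<open>32 - 1\<close>.\<close>

lemma entry_sparsity_bound:
  fixes C :: real
  assumes P: "partition_on I P" "finite I" and b: "\<And>G. G \<in> P \<Longrightarrow> card G = b"
    and s: "s \<ge> 1" "sg \<ge> 1" and C: "C > 0"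
    and f: "\<And>k. k < n \<Longrightarrow> lin_fun (f k)"
    and ker: "\<And>v. (\<And>k. k < n \<Longrightarrow> f k v = 0) \<Longrightarrow> L2_set v I \<le> C * mixed_norm s sg I P v"
    and t: "t \<ge> 1" "t \<le> \<tau> * b" and \<tau>: "\<tau> \<le> card P" and ratio: "2 * \<tau> * s \<le> 841 * t * sg"
    and small: "C * (sqrt (real (2 * t) / real s) + sqrt (real \<tau> / real sg)) \<le> 1 / 2"
  shows "real t * ln (real (\<tau> * b div t) / 4) \<le> 2 * real n * ln 32"
proof -
  let ?N = "mixed_norm s sg I P"
  have finP: "finite P" using finite_elements[OF P(2,1)] .
  obtain Q where Q: "Q \<subseteq> P" "card Q = \<tau>" using obtain_subset_with_card_n[OF \<tau>] by metis
  define U where "U = \<Union>Q"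
  have UI: "U \<subseteq> I" using Q partition_onD1[OF P(1)] by (auto simp: U_def)
  have finU: "finite U" using finite_subset[OF UI P(2)] .
  have fin: "finite G" if "G \<in> P" for G
    using partition_onD1[OF P(1)] P(2) that finite_subset[of G I] by blast
  have cU: "card U = \<tau> * b"
  proof -
    have "card U = (\<Sum>G\<in>Q. card G)" unfolding U_def
      using partition_onD2[OF P(1)] fin Q
      by (intro card_Union_disjoint) (auto simp: disjoint_def pairwise_def disjnt_def)
    also have "\<dots> = (\<Sum>G\<in>Q. b)" using b Q by (intro sum.cong) auto
    finally show ?thesis using Q by simp
  qed
  define \<delta> where "\<delta> = real t / sqrt (real s)"
  have \<delta>: "\<delta> > 0" using t s by (simp add: \<delta>_def)
  have "real t * ln (real (\<tau> * b div t) / 4) \<le> 2 * real n * ln (real 32)"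
  proof (rule sparse_packing_bound[where N = ?N and f = f and U = U and \<delta> = \<delta>])
    show "seminorm ?N" by (rule seminorm_mixed_norm)
    show "lin_fun (f k)" if "k < n" for k using f[OF that] .
    show "t * (\<tau> * b div t) \<le> card U" by (simp add: cU)
    show "1 \<le> \<tau> * b div t" using t by (simp add: div_greater_zero_iff Suc_le_eq)
  next
    fix S T assume ST: "S \<subseteq> U" "T \<subseteq> U" "card S = t" "card T = t"
    let ?x = "\<lambda>i. of_bool (i \<in> S) - of_bool (i \<in> T) :: real"
    have x1: "(\<Sum>i\<in>I. \<bar>?x i\<bar>) \<le> 2 * real t"
      using sum_abs_diff_of_bool[OF P(2), of S T t] ST UI by auto
    \<comment> \<open>The entries of \<open>?x\<close> are -1, 0 or 1, so squares equal absolute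
      values.\<close>
    have "(\<Sum>i\<in>I. (?x i)\<^sup>2) = (\<Sum>i\<in>I. \<bar>?x i\<bar>)" by (rule sum.cong) auto
    then have x2: "L2_set ?x I \<le> sqrt (2 * real t)"
      using x1 by (simp add: L2_set_def)
    have "(\<Sum>G\<in>P. L2_set ?x G) = (\<Sum>G\<in>Q. L2_set ?x G)"
    proof (rule sum.mono_neutral_right[OF finP Q(1)], rule ballI)
      fix G assume G: "G \<in> P - Q"
      have "?x i = 0" if "i \<in> G" for i
      proof -
        have "i \<notin> U"
        proof
          assume "i \<in> U"
          then obtain H where H: "H \<in> Q" "i \<in> H" unfolding U_def by (rule UnionE)
          then have "H \<in> P" "H \<noteq> G" using G Q(1) by auto
          then show False using disjointD[OF partition_onD2[OF P(1)], of H G] G H that by auto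
        qed
        then show ?thesis using ST by auto
      qed
      then show "L2_set ?x G = 0" unfolding L2_set_def by simp
    qed
    also have "\<dots> \<le> sqrt (real \<tau>) * L2_set ?x I" using sum_L2_set_le[OF P Q(1), of ?x] Q by simp
    also have "\<dots> \<le> sqrt (real \<tau>) * sqrt (2 * real t)" using x2 by (intro mult_left_mono) auto
    finally have x3: "(\<Sum>G\<in>P. L2_set ?x G) \<le> sqrt (real \<tau>) * sqrt (2 * real t)" .
    have "real (2 * \<tau> * s) \<le> real (841 * t * sg)" using ratio by (rule of_nat_mono)
    \<comment> \<open>Multiplying by \<open>t\<close> prepares the perfect square of
      \<open>29 * t\<close> for the square root.\<close>
    then have "2 * real \<tau> * real t * real s \<le> 841 * real t * real t * real sg"
      using mult_left_mono[of "2 * real \<tau> * real s" "841 * real t * real sg" "real t"]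
      by (simp add: algebra_simps)
    then have "real \<tau> * (2 * real t) / real sg \<le> (29 * real t)\<^sup>2 / real s"
      using s by (simp add: field_simps power2_eq_square)
    then have "sqrt (real \<tau> * (2 * real t) / real sg) \<le> sqrt ((29 * real t)\<^sup>2 / real s)"
      by (rule real_sqrt_le_mono)
    then have x4: "sqrt (real \<tau>) * sqrt (2 * real t) / sqrt (real sg) \<le> 29 * real t / sqrt (real s)"
      by (simp add: real_sqrt_divide real_sqrt_mult)
    have "?N ?x \<le> 2 * real t / sqrt (real s) + sqrt (real \<tau>) * sqrt (2 * real t) / sqrt (real sg)"
      unfolding mixed_norm_def using x1 x3 by (intro add_mono divide_right_mono) auto
    also have "\<dots> \<le> 2 * real t / sqrt (real s) + 29 * real t / sqrt (real s)" using x4 by simp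
    also have "\<dots> = 31 * \<delta>" by (simp add: \<delta>_def)
    finally show "?N ?x \<le> (real 32 - 1) * \<delta>" by simp
  next
    fix S T v assume ST: "S \<subseteq> U" "T \<subseteq> U" "card S = t" "card T = t" "2 * card (S \<inter> T) < t"
      and v: "\<And>k. k < n \<Longrightarrow> f k v = 0"
    let ?x = "\<lambda>i. of_bool (i \<in> S) - of_bool (i \<in> T) :: real"
    have "real t \<le> (\<Sum>i\<in>I. \<bar>?x i\<bar>)"
      using sum_abs_diff_of_bool[OF P(2), of S T t] ST UI by auto
    then have "\<delta> \<le> (\<Sum>i\<in>I. \<bar>?x i\<bar>) / sqrt (real s)"
      unfolding \<delta>_def by (intro divide_right_mono) auto
    also have "\<dots> \<le> ?N ?x" unfolding mixed_norm_def by (simp add: sum_nonneg)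
    also have "\<dots> \<le> ?N (\<lambda>i. ?x i - v i)"
    proof (rule sparse_minimal_in_coset[OF P s C ker[OF v], where S = "S \<union> T" and Q = Q])
      show "card (S \<union> T) \<le> 2 * t" using card_Un_le[of S T] ST by simp
    qed (use small Q ST UI in \<open>auto simp: U_def\<close>)
    finally show "\<delta> \<le> ?N (\<lambda>i. ?x i - v i)" .
  qed (use finU \<delta> in auto)
  then show ?thesis by simp
qed

subsection \<open>The lower bound\<close>

lemma L2_set_le_of_antipodal:
  assumes "L2_set (\<lambda>i. v i - z i) I \<le> c" "L2_set (\<lambda>i. - v i - z i) I \<le> c"
  shows "L2_set v I \<le> c"
proof -
  have "2 * L2_set v I = L2_set (\<lambda>i. (v i - z i) + (-1) * (- v i - z i)) I"
    using L2_set_scale[of 2 v I] by simp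
  also have "\<dots> \<le> L2_set (\<lambda>i. v i - z i) I + L2_set (\<lambda>i. (-1) * (- v i - z i)) I"
    by (rule L2_set_triangle_ineq)
  also have "\<dots> = L2_set (\<lambda>i. v i - z i) I + L2_set (\<lambda>i. - v i - z i) I"
    by (subst L2_set_scale) simp
  finally show ?thesis using assms by simp
qed

text \<open>\<open>v\<close> and \<open>- v\<close> have the same measurement 0, hence the same
  reconstruction \<open>z\<close>. Being close to both forces \<open>v\<close> to be small.\<close>

lemma instance_optimal_kernel_bound:
  fixes X :: "real mat"
  assumes P: "partition_on {..<p} P" and X: "X \<in> carrier_mat n p"
    and \<Delta>: "\<Delta> \<in> carrier_vec n \<rightarrow> carrier_vec p"
    and opt: "\<And>\<beta>. \<beta> \<in> carrier_vec p \<Longrightarrow> vec_norm2 (\<beta> - \<Delta> (X *\<^sub>v \<beta>))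
      \<le> C * (vec_norm1 \<beta> / sqrt (real s) + vec_norm12 P \<beta> / sqrt (real sg))"
    and v: "\<And>k. k < n \<Longrightarrow> (\<Sum>i<p. X $$ (k, i) * v i) = 0"
  shows "L2_set v {..<p} \<le> C * mixed_norm s sg {..<p} P v"
proof -
  define z where "z = \<Delta> (0\<^sub>v n)"
  have z: "z \<in> carrier_vec p" using \<Delta> by (auto simp: z_def)
  \<comment> \<open>Both signs are treated at once: \<open>c\<close> is 1 or -1, and
    \<open>z\<close> does not depend on it.\<close>
  have bound: "L2_set (\<lambda>i. c * v i - z $ i) {..<p} \<le> C * mixed_norm s sg {..<p} P v"
    if c: "\<bar>c\<bar> = 1" for c
  proof -
    let ?\<beta> = "vec p (\<lambda>i. c * v i)"
    have "X *\<^sub>v ?\<beta> = 0\<^sub>v n"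
    proof (rule eq_vecI)
      fix k assume "k < dim_vec (0\<^sub>v n :: real vec)"
      then have k: "k < n" by simp
      have "(X *\<^sub>v ?\<beta>) $ k = (\<Sum>i<p. X $$ (k, i) * (c * v i))"
        using X k by (simp add: scalar_prod_def lessThan_atLeast0)
      also have "\<dots> = c * (\<Sum>i<p. X $$ (k, i) * v i)"
        by (simp add: sum_distrib_left algebra_simps)
      finally show "(X *\<^sub>v ?\<beta>) $ k = 0\<^sub>v n $ k" using v[OF k] k by simp
    qed (use X in simp)
    then have "vec_norm2 (?\<beta> - z)
        \<le> C * (vec_norm1 ?\<beta> / sqrt (real s) + vec_norm12 P ?\<beta> / sqrt (real sg))"
      using opt[of ?\<beta>] by (simp add: z_def)
    moreover have "vec_norm2 (?\<beta> - z) = L2_set (\<lambda>i. c * v i - z $ i) {..<p}"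
      unfolding vec_norm2_def using z by (intro L2_set_cong) auto
    moreover have "vec_norm1 ?\<beta> = (\<Sum>i<p. \<bar>v i\<bar>)"
      using c by (simp add: vec_norm1_def abs_mult)
    moreover have "vec_norm12 P ?\<beta> = (\<Sum>G\<in>P. L2_set v G)"
      unfolding vec_norm12_def
    proof (rule sum.cong[OF refl])
      fix G assume "G \<in> P"
      then have "G \<subseteq> {..<p}" using partition_onD1[OF P] by blast
      then have "L2_set (($) ?\<beta>) G = L2_set (\<lambda>i. c * v i) G" by (intro L2_set_cong) auto
      then show "L2_set (($) ?\<beta>) G = L2_set v G" using c by (simp add: L2_set_scale)
    qed
    ultimately show ?thesis by (simp add: mixed_norm_def)
  qed
  show ?thesis
    by (rule L2_set_le_of_antipodal[where z = "($) z"]) (use bound[of 1] bound[of "-1"] in simp_all)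
qed

section \<open>Rounding the sparsity levels to integers\<close>

lemma real_div_ge_half:
  assumes "t \<ge> 1" "t \<le> m"
  shows "real m / (2 * real t) \<le> real (m div t)"
proof -
  have "m div t \<ge> 1" using assms by (simp add: div_greater_zero_iff Suc_le_eq)
  moreover have "m < t * (m div t + 1)"
    using assms dividend_less_times_div[of t m] by (simp add: algebra_simps)
  moreover from calculation(1) have "t * (m div t + 1) \<le> t * (2 * (m div t))"
    by (intro mult_le_mono2) simp
  ultimately have "m \<le> t * (2 * (m div t))" by linarith
  then have "real m \<le> real (t * (2 * (m div t)))" by (rule of_nat_mono)
  then show ?thesis using assms by (simp add: field_simps)
qed

lemma floor_half:
  fixes x :: real
  assumes "x \<ge> 1"
  shows "nat \<lfloor>x\<rfloor> \<ge> 1" "real (nat \<lfloor>x\<rfloor>) \<le> x" "x / 2 \<le> real (nat \<lfloor>x\<rfloor>)"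
proof -
  have "\<lfloor>x\<rfloor> \<ge> 1" using assms by simp
  then have "real (nat \<lfloor>x\<rfloor>) = of_int \<lfloor>x\<rfloor>" "real_of_int \<lfloor>x\<rfloor> \<ge> 1" by simp_all
  then show "nat \<lfloor>x\<rfloor> \<ge> 1" "real (nat \<lfloor>x\<rfloor>) \<le> x" "x / 2 \<le> real (nat \<lfloor>x\<rfloor>)"
    using \<open>\<lfloor>x\<rfloor> \<ge> 1\<close> real_of_int_floor_add_one_gt[of x] of_int_floor_le[of x] by linarith+
qed

text \<open>Collects the rounding losses: a factor 2 between \<open>\<kappa> * a\<close> and the
  integer \<open>t\<close>, and in the logarithm the 4 from the code bound times 2 for integer
  division, which makes the 8.\<close>

lemma sparsity_bound_rescale:
  fixes \<kappa> a y :: real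
  assumes "real t * ln (real (m div t) / 4) \<le> 2 * real n * ln 32"
    and "\<kappa> * a / 2 \<le> real t" "t \<ge> 1" "t \<le> m" "\<kappa> * a \<ge> 0" "y \<ge> 1" "y \<le> real m / (8 * real t)"
  shows "\<kappa> * a * ln y \<le> 4 * real n * ln 32"
proof -
  have "y \<le> real (m div t) / 4" using assms(7) real_div_ge_half[OF assms(3,4)] by simp
  then have "ln y \<le> ln (real (m div t) / 4)" using assms(6) by simp
  then have "\<kappa> * a / 2 * ln y \<le> real t * ln (real (m div t) / 4)"
    using assms(2,5,6) by (intro mult_mono) auto
  then show ?thesis using assms(1) by simp
qed

theorem theorem3:
  fixes C :: real
  assumes "C > 0"
  shows "\<exists>C0 c0 :: real. C0 > 0 \<and> c0 > 0 \<and>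
    (\<forall>(b::nat) (d::nat) (P::nat set set) (s::nat) (sg::nat) (n::nat).
       b \<ge> 3 \<longrightarrow> d \<ge> 3 \<longrightarrow> equal_groups b d P \<longrightarrow>
       s \<ge> 1 \<longrightarrow> sg \<ge> 1 \<longrightarrow> d \<ge> sg \<longrightarrow> sg * b \<ge> s \<longrightarrow> s \<ge> sg \<longrightarrow>
       (\<exists>X \<in> carrier_mat n (b * d). \<exists>\<Delta> \<in> carrier_vec n \<rightarrow> carrier_vec (b * d).
          \<forall>\<beta> \<in> carrier_vec (b * d).
            vec_norm2 (\<beta> - \<Delta> (X *\<^sub>v \<beta>))
              \<le> C * (vec_norm1 \<beta> / sqrt (real s) + vec_norm12 P \<beta> / sqrt (real sg))) \<longrightarrow>
       real sg \<ge> C0 \<longrightarrow>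
       real n \<ge> c0 * (real sg * ln (real d / real sg)
                       + real s * ln (exp 1 * real sg * real b / real s)))"
proof -
  \<comment> \<open>The first entry bounds \<open>sqrt (2 * \<kappa>)\<close> by
    \<open>1 / (10 * C)\<close> and \<open>sqrt (64 * \<kappa>)\<close> by
    \<open>2 / (5 * C)\<close>, whose sum is the permitted \<open>1 / (2 * C)\<close>. The second
    keeps \<open>64 * \<kappa> * sg\<close> below \<open>sg\<close>, hence below the number of
    groups.\<close>
  define \<kappa> where "\<kappa> = min (1 / (400 * C\<^sup>2)) (1 / 128)"
  have \<kappa>: "\<kappa> > 0" "\<kappa> \<le> 1 / 128" "\<kappa> \<le> 1 / (400 * C\<^sup>2)" using assms by (auto simp: \<kappa>_def)
  have sqrt64: "sqrt (64 * \<kappa>) \<le> 2 / (5 * C)"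
  proof (rule real_le_lsqrt)
    show "64 * \<kappa> \<le> (2 / (5 * C))\<^sup>2" using \<kappa>(3) by (simp add: power_divide power_mult_distrib)
  qed (use assms in simp_all)
  have sqrt2: "sqrt (2 * \<kappa>) \<le> 1 / (10 * C)"
  proof (rule real_le_lsqrt)
    have "1 / (200 * C\<^sup>2) \<le> 1 / (100 * C\<^sup>2)" using assms by (simp add: field_simps)
    then show "2 * \<kappa> \<le> (1 / (10 * C))\<^sup>2" using \<kappa>(3) by (simp add: power_divide power_mult_distrib)
  qed (use assms in simp_all)
  have "real n \<ge> \<kappa> / (8 * ln 32) * (real sg * ln (real d / real sg)
                       + real s * ln (exp 1 * real sg * real b / real s))"
    if b: "b \<ge> 3" and d: "d \<ge> 3" and eg: "equal_groups b d P"
      and s: "s \<ge> 1" "sg \<ge> 1" and dsg: "d \<ge> sg" and sgb: "sg * b \<ge> s" and ssg: "s \<ge> sg"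
      and X: "X \<in> carrier_mat n (b * d)" and \<Delta>: "\<Delta> \<in> carrier_vec n \<rightarrow> carrier_vec (b * d)"
      and opt: "\<forall>\<beta> \<in> carrier_vec (b * d). vec_norm2 (\<beta> - \<Delta> (X *\<^sub>v \<beta>))
              \<le> C * (vec_norm1 \<beta> / sqrt (real s) + vec_norm12 P \<beta> / sqrt (real sg))"
      and sg: "real sg \<ge> 1 / \<kappa>"
    for b d P s sg n X \<Delta>
  proof -
    let ?I = "{..<b * d}"
    have P: "partition_on ?I P" "finite ?I" and cP: "card P = d" and bP: "\<And>G. G \<in> P \<Longrightarrow> card G = b"
      using eg by (auto simp: equal_groups_def)
    define f where "f k v = (\<Sum>i<b * d. X $$ (k, i) * v i)" for k and v :: "nat \<Rightarrow> real"
    have f: "lin_fun (f k)" for k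
      by (simp add: lin_fun_def f_def sum.distrib sum_distrib_left algebra_simps)
    have ker: "L2_set v ?I \<le> C * mixed_norm s sg ?I P v" if v: "\<And>k. k < n \<Longrightarrow> f k v = 0" for v
      by (rule instance_optimal_kernel_bound[OF P(1) X \<Delta>]) (use opt v in \<open>auto simp: f_def\<close>)
    \<comment> \<open>The threshold on \<open>sg\<close> ensures that the three quantities rounded
      down below are at least 1.\<close>
    have ksg: "\<kappa> * real sg \<ge> 1" using sg \<kappa>(1) by (simp add: field_simps)
    have kssg: "\<kappa> * real sg \<le> \<kappa> * real s" using ssg \<kappa>(1) by simp
    have ks: "\<kappa> * real s \<ge> 1" using ksg kssg by linarith
    have spos: "real s > 0" "real sg > 0" using s by auto

    define t where "t = nat \<lfloor>\<kappa> * real sg\<rfloor>"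
    note t = floor_half[OF ksg, folded t_def]
    have "real t \<le> real d"
    proof -
      have "\<kappa> * real sg \<le> 1 * real sg" using \<kappa> by (intro mult_right_mono) auto
      then show ?thesis using t(2) dsg by linarith
    qed
    then have td: "t \<le> d" by simp
    have "real t * ln (real (card P div t) / 4) \<le> 2 * real n * ln 32"
    proof (rule group_sparsity_bound[OF P s assms f ker t(1)])
      have "sqrt (real (2 * t) / real s) \<le> sqrt (2 * \<kappa>)"
        using t(2) kssg spos by (intro real_sqrt_le_mono) (simp add: field_simps)
      moreover have "sqrt (real (2 * t) / real sg) \<le> sqrt (2 * \<kappa>)"
        using t(2) spos by (intro real_sqrt_le_mono) (simp add: field_simps)
      ultimately have "sqrt (real (2 * t) / real s) + sqrt (real (2 * t) / real sg) \<le> 2 * (1 / (10 * C))"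
        using sqrt2 by linarith
      then have "C * (sqrt (real (2 * t) / real s) + sqrt (real (2 * t) / real sg)) \<le> C * (2 * (1 / (10 * C)))"
        using assms by (intro mult_left_mono) auto
      then show "C * (sqrt (real (2 * t) / real s) + sqrt (real (2 * t) / real sg)) \<le> 1 / 2"
        using assms by simp
    qed (use td cP in auto)
    then have groups: "\<kappa> * real sg * ln (real d / real sg) \<le> 4 * real n * ln 32"
    proof (rule sparsity_bound_rescale[OF _ t(3) t(1)])
      show "1 \<le> real d / real sg" using dsg spos by simp
      \<comment> \<open>With \<open>8 * t \<le> sg\<close> the quotient \<open>d / sg\<close> is at
        most \<open>d / (8 * t)\<close>, the form that rescaling asks for.\<close>
      have "8 * real t \<le> 8 * (\<kappa> * real sg)" using t(2) by simp
      moreover have "8 * \<kappa> * real sg \<le> 1 * real sg" using \<kappa> by (intro mult_right_mono) auto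
      ultimately have "8 * real t \<le> real sg" by simp
      then show "real d / real sg \<le> real (card P) / (8 * real t)"
        using t(1) cP spos by (intro frac_le) auto
    qed (use td cP ksg in auto)

    have k64: "64 * \<kappa> * real sg \<ge> 1" using ksg by simp
    define u where "u = nat \<lfloor>\<kappa> * real s\<rfloor>"
    note u = floor_half[OF ks, folded u_def]
    \<comment> \<open>Of the factor 64, rounding down keeps 32 and rescaling divides by 8. The
      remaining \<open>4 * sg * b / s\<close> dominates the argument of the logarithm, as
      \<open>exp 1\<close> is below 4.\<close>
    define \<tau> where "\<tau> = nat \<lfloor>64 * \<kappa> * real sg\<rfloor>"
    note \<tau> = floor_half[OF k64, folded \<tau>_def]
    have "real \<tau> \<le> real d"
    proof -
      have "64 * \<kappa> * real sg \<le> 1 * real sg" using \<kappa> by (intro mult_right_mono) auto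
      then show ?thesis using \<tau>(2) dsg by linarith
    qed
    then have \<tau>d: "\<tau> \<le> card P" using cP by simp
    have sb: "real s \<le> real sg * real b" using sgb by (metis of_nat_le_iff of_nat_mult)
    have \<tau>b: "32 * \<kappa> * (real sg * real b) \<le> real \<tau> * real b"
      using mult_right_mono[OF \<tau>(3), of "real b"] by (simp add: algebra_simps)
    have "real u \<le> real (\<tau> * b)"
    proof -
      have "\<kappa> * real s \<le> \<kappa> * (real sg * real b)" using sb \<kappa> by (intro mult_left_mono) auto
      also have "\<dots> \<le> 32 * \<kappa> * (real sg * real b)" using \<kappa> by (simp add: mult_right_mono)
      finally show ?thesis using u(2) \<tau>b by simp
    qed
    then have u\<tau>: "u \<le> \<tau> * b" by (simp only: of_nat_le_iff)
    have "real u * ln (real (\<tau> * b div u) / 4) \<le> 2 * real n * ln 32"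
    proof (rule entry_sparsity_bound[OF P bP s assms f ker u(1) u\<tau> \<tau>d])
      \<comment> \<open>\<open>\<tau>\<close> is at most \<open>64 * \<kappa> * sg\<close> and
        \<open>u\<close> at least \<open>\<kappa> * s / 2\<close>, so the ratio condition holds with
        256, within the allowed 841.\<close>
      have "real \<tau> * real s \<le> 64 * \<kappa> * real sg * real s"
        using \<tau>(2) by (intro mult_right_mono) auto
      also have "\<dots> = 128 * (\<kappa> * real s / 2) * real sg" by simp
      also have "\<dots> \<le> 128 * real u * real sg"
        using u(3) by (intro mult_right_mono mult_left_mono) auto
      finally have "real (\<tau> * s) \<le> real (128 * u * sg)" by simp
      then have "\<tau> * s \<le> 128 * u * sg" by (simp only: of_nat_le_iff)
      then show "2 * \<tau> * s \<le> 841 * u * sg" by simp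
    next
      have "sqrt (real (2 * u) / real s) \<le> sqrt (2 * \<kappa>)"
        using u(2) spos by (intro real_sqrt_le_mono) (simp add: field_simps)
      moreover have "sqrt (real \<tau> / real sg) \<le> sqrt (64 * \<kappa>)"
        using \<tau>(2) spos by (intro real_sqrt_le_mono) (simp add: field_simps)
      ultimately have "sqrt (real (2 * u) / real s) + sqrt (real \<tau> / real sg) \<le> 1 / (10 * C) + 2 / (5 * C)"
        using sqrt2 sqrt64 by linarith
      then have "C * (sqrt (real (2 * u) / real s) + sqrt (real \<tau> / real sg)) \<le> C * (1 / (10 * C) + 2 / (5 * C))"
        using assms by (intro mult_left_mono) auto
      also have "\<dots> = 1 / 2" using assms by (simp add: field_simps)
      finally show "C * (sqrt (real (2 * u) / real s) + sqrt (real \<tau> / real sg)) \<le> 1 / 2" .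
    qed auto
    then have entries: "\<kappa> * real s * ln (exp 1 * real sg * real b / real s) \<le> 4 * real n * ln 32"
    proof (rule sparsity_bound_rescale[OF _ u(3) u(1) u\<tau>])
      have "1 * real s \<le> exp 1 * (real sg * real b)" using sb by (intro mult_mono) auto
      then show "1 \<le> exp 1 * real sg * real b / real s" using spos by (simp add: algebra_simps)
      have "exp 1 * real sg * real b / real s \<le> 4 * (real sg * real b) / real s"
        using exp_le by (intro divide_right_mono) (auto simp: mult.assoc intro!: mult_right_mono)
      also have "\<dots> = 32 * \<kappa> * (real sg * real b) / (8 * (\<kappa> * real s))"
        using \<kappa>(1) spos by (simp add: field_simps)
      also have "\<dots> \<le> real (\<tau> * b) / (8 * real u)"
        using \<tau>b u(1,2) by (intro frac_le) auto
      finally show "exp 1 * real sg * real b / real s \<le> real (\<tau> * b) / (8 * real u)" .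
    qed (use ks in auto)
    \<comment> \<open>Each term times \<open>\<kappa>\<close> is at most
      \<open>4 * n * ln 32\<close>; adding the two gives the 8 in the constant.\<close>
    show ?thesis using groups entries by (simp add: field_simps)
  qed
  then show ?thesis
    using \<kappa>(1) by (intro exI[of _ "1 / \<kappa>"] exI[of _ "\<kappa> / (8 * ln 32)"]) auto
qed

end
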